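(* There is a set $X\subseteq\omega$ which is intrinsically small but not $0$-weakly stochastic.
   Context: For $B\subseteq\omega$ and $n\geq1$, $\rho_n(B)=\frac{|B\cap\{0,\dots,n-1\}|}{n}$ and $\rho(B)=\lim_n\rho_n(B)$ when it exists. $X$ is intrinsically small if $\rho(\pi(X))=0$ for every computable permutation $\pi$ of $\omega$. A skip sequence is a finite sequence $((d_0,b_0),\dots,(d_{k-1},b_{k-1}))\in(\omega\times\{0,1\})^{<\omega}$ with $d_0<\dots<d_{k-1}$. A skip rule is a total function $f$ from skip sequences to $\omega$ with $f(\sigma)$ greater than the last first coordinate of $\sigma$ for every nonempty $\sigma$. Given a skip rule $f$ and $A\subseteq\omega$, set $d_0=f(\emptyset)$, $d_n=f(((d_0,A(d_0)),\dots,(d_{n-1},A(d_{n-1}))))$, and $f(A)=\{n: A(d_n)=1\}$. $A$ is $0$-weakly stochastic if $\rho(f(A))=0$ for every computable skip rule $f$. *)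

theory Defs
  imports Complex_Main "HOL-Library.Nat_Bijection"
begin

section \<open>Computability\<close>

text \<open>
  Partial recursive functions, given by terms of Kleene's schemes. Arities are not recorded in
  the syntax: \<open>Zero\<close> and \<open>Proj i\<close> stand for the constants and projections of every suitable
  arity, and the length of the initial argument list fixes the arities of all subterms.
\<close>

datatype recf =
    Zero
  | Succ
  | Proj nat
  | Comp recf "recf list"
  | PrimRec recf recf
  | Mu recf

inductive evaluates :: "recf \<Rightarrow> nat list \<Rightarrow> nat \<Rightarrow> bool" where
  Zero: "evaluates Zero xs 0"
| Succ: "evaluates Succ [x] (Suc x)"
| Proj: "i < length xs \<Longrightarrow> evaluates (Proj i) xs (xs ! i)"
| Comp: "list_all2 (\<lambda>g y. evaluates g xs y) gs ys \<Longrightarrow> evaluates f ys z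
    \<Longrightarrow> evaluates (Comp f gs) xs z"
| PrimRec_0: "evaluates f xs y \<Longrightarrow> evaluates (PrimRec f g) (0 # xs) y"
| PrimRec_Suc: "evaluates (PrimRec f g) (n # xs) y \<Longrightarrow> evaluates g (n # y # xs) z
    \<Longrightarrow> evaluates (PrimRec f g) (Suc n # xs) z"
| Mu: "evaluates f (n # xs) 0 \<Longrightarrow> (\<And>m. m < n \<Longrightarrow> \<exists>y. evaluates f (m # xs) (Suc y))
    \<Longrightarrow> evaluates (Mu f) xs n"

inductive_cases evaluates_ZeroE: "evaluates Zero xs y"
inductive_cases evaluates_SuccE: "evaluates Succ xs y"
inductive_cases evaluates_ProjE: "evaluates (Proj i) xs y"
inductive_cases evaluates_CompE: "evaluates (Comp f gs) xs y"
inductive_cases evaluates_PrimRec_0E: "evaluates (PrimRec f g) (0 # xs) y"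
inductive_cases evaluates_PrimRec_SucE: "evaluates (PrimRec f g) (Suc n # xs) y"
inductive_cases evaluates_MuE: "evaluates (Mu f) xs y"

lemma evaluates_deterministic:
  "evaluates r xs y \<Longrightarrow> evaluates r xs z \<Longrightarrow> y = z"
proof (induction arbitrary: z rule: evaluates.induct)
  case (Zero xs)
  then show ?case by (rule evaluates_ZeroE) simp
next
  case (Succ x)
  then show ?case by (rule evaluates_SuccE) simp
next
  case (Proj i xs)
  from Proj.prems show ?case by (rule evaluates_ProjE) simp
next
  case (Comp xs gs ys f w)
  from Comp.prems obtain ys' where ys': "list_all2 (\<lambda>g y. evaluates g xs y) gs ys'"
    "evaluates f ys' z" by (rule evaluates_CompE) blast
  have "ys = ys'"
  proof (rule nth_equalityI)
    show "length ys = length ys'"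
      using Comp.IH(1) ys'(1) by (simp add: list_all2_conv_all_nth)
    show "ys ! i = ys' ! i" if "i < length ys" for i
      using Comp.IH(1) ys'(1) that by (simp add: list_all2_conv_all_nth)
  qed
  with Comp.IH(2) ys'(2) show ?case by simp
next
  case (PrimRec_0 f xs y g)
  from PrimRec_0.prems show ?case
    by (rule evaluates_PrimRec_0E) (rule PrimRec_0.IH)
next
  case (PrimRec_Suc f g n xs y w)
  from PrimRec_Suc.prems obtain y' where
    "evaluates (PrimRec f g) (n # xs) y'" "evaluates g (n # y' # xs) z"
    by (rule evaluates_PrimRec_SucE)
  with PrimRec_Suc.IH show ?case by metis
next
  case (Mu f n xs)
  from Mu.prems have z: "evaluates f (z # xs) 0"
    "\<And>m. m < z \<Longrightarrow> \<exists>y. evaluates f (m # xs) (Suc y)"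
    by (rule evaluates_MuE, blast)+
  have "\<not> n < z"
    using Mu.IH(1) z(2) by (metis nat.distinct(1))
  moreover have "\<not> z < n"
    using Mu.IH(2) z(1) by (metis nat.distinct(1))
  ultimately show ?case by simp
qed

definition computable :: "(nat \<Rightarrow> nat) \<Rightarrow> bool" where
  "computable f \<longleftrightarrow> (\<exists>r. \<forall>n. evaluates r [n] (f n))"


section \<open>Asymptotic density\<close>

definition partial_density :: "nat \<Rightarrow> nat set \<Rightarrow> real" where
  "partial_density n B = real (card (B \<inter> {..<n})) / real n"

definition has_density :: "nat set \<Rightarrow> real \<Rightarrow> bool" where
  "has_density B r \<longleftrightarrow> (\<lambda>n. partial_density n B) \<longlonglongrightarrow> r"

definition intrinsically_small :: "nat set \<Rightarrow> bool" where
  "intrinsically_small X \<longleftrightarrow>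
    (\<forall>\<pi>. bij \<pi> \<and> computable \<pi> \<longrightarrow> has_density (\<pi> ` X) 0)"


section \<open>Skip rules and weak stochasticity\<close>

definition skip_seq :: "(nat \<times> bool) list \<Rightarrow> bool" where
  "skip_seq \<sigma> \<longleftrightarrow> sorted_wrt (<) (map fst \<sigma>)"

text \<open>
  Only the values of a skip rule on skip sequences are meaningful; its values on other lists
  are unconstrained, also as far as computability is concerned.
\<close>

definition skip_rule :: "((nat \<times> bool) list \<Rightarrow> nat) \<Rightarrow> bool" where
  "skip_rule f \<longleftrightarrow> (\<forall>\<sigma>. skip_seq \<sigma> \<and> \<sigma> \<noteq> [] \<longrightarrow> fst (last \<sigma>) < f \<sigma>)"

definition skip_seq_encode :: "(nat \<times> bool) list \<Rightarrow> nat" where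
  "skip_seq_encode \<sigma> = list_encode (map (\<lambda>(d, b). prod_encode (d, of_bool b)) \<sigma>)"

definition computable_skip_rule :: "((nat \<times> bool) list \<Rightarrow> nat) \<Rightarrow> bool" where
  "computable_skip_rule f \<longleftrightarrow>
    skip_rule f \<and> (\<exists>r. \<forall>\<sigma>. skip_seq \<sigma> \<longrightarrow> evaluates r [skip_seq_encode \<sigma>] (f \<sigma>))"

text \<open>\<open>skip_history f A n\<close> is \<open>((d\<^sub>0, A(d\<^sub>0)), \<dots>, (d\<^sub>n\<^sub>-\<^sub>1, A(d\<^sub>n\<^sub>-\<^sub>1)))\<close>.\<close>

primrec skip_history ::
  "((nat \<times> bool) list \<Rightarrow> nat) \<Rightarrow> nat set \<Rightarrow> nat \<Rightarrow> (nat \<times> bool) list" where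
  "skip_history f A 0 = []"
| "skip_history f A (Suc n) =
    (let \<sigma> = skip_history f A n in \<sigma> @ [(f \<sigma>, f \<sigma> \<in> A)])"

definition skip_select :: "((nat \<times> bool) list \<Rightarrow> nat) \<Rightarrow> nat set \<Rightarrow> nat \<Rightarrow> nat" where
  "skip_select f A n = f (skip_history f A n)"

definition skip_image :: "((nat \<times> bool) list \<Rightarrow> nat) \<Rightarrow> nat set \<Rightarrow> nat set" where
  "skip_image f A = {n. skip_select f A n \<in> A}"

definition weakly_stochastic_0 :: "nat set \<Rightarrow> bool" where
  "weakly_stochastic_0 A \<longleftrightarrow>
    (\<forall>f. computable_skip_rule f \<longrightarrow> has_density (skip_image f A) 0)"

end

theory Submission
  imports Defs "HOL-Library.Countable_Set" "HOL-Library.Extended_Nonnegative_Real"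
    "HOL-Analysis.Summation_Tests"
begin

text \<open>
  Regard \<open>\<nat>\<close> as a binary tree in which \<open>v\<close> has the children \<open>2 v + 1\<close> and \<open>2 v + 2\<close>, and let
  \<open>X\<close> be a branch. A skip rule can follow the branch, as of the two children of the current node
  one is always a hit; so at least every other selected number is in \<open>X\<close>.

  For an injective \<open>\<pi>\<close>, the sum of \<open>1 / (\<pi> v + 1)\<close> along a uniformly random branch has expectation
  at most \<open>\<Sum>v. 2 / ((v + 1) (\<pi> v + 1))\<close>, which is bounded independently of \<open>\<pi>\<close>.
  As there are only countably many computable permutations, the weights
  \<open>\<Sum>i. 2\<^sup>-\<^sup>i / (\<pi>\<^sub>i v + 1)\<close> have finite expected sum as well, and always moving to the
  child with the smaller conditional expectation gives a branch \<open>X\<close> on which they are summable. Then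
  the reciprocals of every \<open>\<pi>\<^sub>i ` X\<close> are summable, which forces its density to be \<open>0\<close>.
\<close>

section \<open>A branch that is light for countably many injections\<close>

text \<open>Here the root is \<open>1\<close> and the children are \<open>2 v\<close> and \<open>2 v + 1\<close>, so that level \<open>n\<close> below
  \<open>v\<close> is an interval of length \<open>2\<^sup>n\<close> starting at \<open>2\<^sup>n v\<close>; \<open>\<Phi> v\<close> is the expected weight of a
  random branch from \<open>v\<close>.\<close>

lemma light_branch:
  fixes W :: "nat \<Rightarrow> ennreal"
  defines "\<Phi> \<equiv> \<lambda>v. \<Sum>n. (1/2)^n * (\<Sum>j<2^n. W (2^n * v + j))"
  obtains x :: "nat \<Rightarrow> nat" where "x 0 = 1" "\<And>n. x (Suc n) = 2 * x n \<or> x (Suc n) = 2 * x n + 1"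
    "\<And>N. (\<Sum>n<N. W (x n)) \<le> \<Phi> 1"
proof -
  \<comment> \<open>The two halves of level n + 1 below v are level n below its two
    children.\<close>
  have split: "(\<Sum>j<2^Suc n. W (2^Suc n * v + j)) =
      (\<Sum>j<2^n. W (2^n * (2 * v) + j)) + (\<Sum>j<2^n. W (2^n * (2 * v + 1) + j))" for n v
  proof -
    have "(\<Sum>j<2^Suc n. W (2^Suc n * v + j)) = (\<Sum>j<2^n. W (2^Suc n * v + j)) +
        (\<Sum>j\<in>{2^n..<2^n+2^n}. W (2^Suc n * v + j))"
      using sum.atLeastLessThan_concat[of 0 "2^n" "2^n+2^n" "\<lambda>j. W (2^Suc n * v + j)"]
      by (simp add: lessThan_atLeast0 mult_2)
    also have "(\<Sum>j\<in>{2^n..<2^n+2^n}. W (2^Suc n * v + j)) =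
        (\<Sum>j<2^n. W (2^Suc n * v + (j + 2^n)))"
      using sum.shift_bounds_nat_ivl[of "\<lambda>j. W (2^Suc n * v + j)" 0 "2^n" "2^n"]
      by (simp add: lessThan_atLeast0)
    finally show ?thesis by (simp add: algebra_simps)
  qed
  \<comment> \<open>Conditioning on the first move: the term n = 0 is \<open>W v\<close>, and
    shifting the index by one produces the factor 1/2.\<close>
  have step: "\<Phi> v = W v + 1/2 * (\<Phi> (2 * v) + \<Phi> (2 * v + 1))" for v
  proof -
    let ?f = "\<lambda>v n. (1/2)^n * (\<Sum>j<2^n. W (2^n * v + j))"
    have "\<Phi> v = (\<Sum>n. ?f v (Suc n)) + ?f v 0"
      unfolding \<Phi>_def using suminf_offset[of "?f v" 1] by (simp add: add.commute)
    also have "(\<lambda>n. ?f v (Suc n)) = (\<lambda>n. 1/2 * (?f (2 * v) n + ?f (2 * v + 1) n))"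
      by (simp only: split[of _ v] power_Suc[of "1/2 :: ennreal"] distrib_left[of "_ :: ennreal"]
          mult.assoc[of "_ :: ennreal"])
    also have "(\<Sum>n. 1/2 * (?f (2 * v) n + ?f (2 * v + 1) n)) =
        1/2 * (\<Phi> (2 * v) + \<Phi> (2 * v + 1))"
      unfolding \<Phi>_def by (subst ennreal_suminf_cmult, subst suminf_add) auto
    finally show ?thesis by (simp add: add.commute)
  qed
  have half: "min a b \<le> 1/2 * (a + b)" for a b :: ennreal
  proof -
    have "1/2 * 2 = (1 :: ennreal)"
      using ennreal_times_divide[of 2 1 2] mult_divide_eq_ennreal[of 2 1] by (simp add: mult.commute)
    then have "min a b = 1/2 * (2 * min a b)" by (simp flip: mult.assoc)
    also have "\<dots> = 1/2 * (min a b + min a b)" by (simp only: mult_2)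
    also have "\<dots> \<le> 1/2 * (a + b)" by (intro mult_left_mono add_mono) auto
    finally show ?thesis .
  qed
  define c where "c v = (if \<Phi> (2 * v) \<le> \<Phi> (2 * v + 1) then 2 * v else 2 * v + 1)" for v
  have c: "W v + \<Phi> (c v) \<le> \<Phi> v" for v
  proof -
    have "\<Phi> (c v) = min (\<Phi> (2 * v)) (\<Phi> (2 * v + 1))" by (auto simp: c_def min_def)
    then show ?thesis using half step[of v] by (simp add: add_left_mono)
  qed
  define x where "x n = (c ^^ n) 1" for n
  \<comment> \<open>The weight collected so far plus the expected weight still to come never exceeds
    its initial value, as the chosen child is at most as heavy as the average of the two.\<close>
  have "(\<Sum>n<N. W (x n)) + \<Phi> (x N) \<le> \<Phi> 1" for N
  proof (induction N)
    case (Suc N)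
    have "(\<Sum>n<Suc N. W (x n)) + \<Phi> (x (Suc N)) = (\<Sum>n<N. W (x n)) + (W (x N) + \<Phi> (c (x N)))"
      by (simp add: x_def add.assoc)
    also have "\<dots> \<le> \<Phi> 1" using c[of "x N"] Suc by (meson add_left_mono order_trans)
    finally show ?case .
  qed (simp add: x_def)
  then have "(\<Sum>n<N. W (x n)) \<le> \<Phi> 1" for N
    by (meson le_iff_add order_trans)
  then show ?thesis by (intro that[of x]) (auto simp: x_def c_def)
qed

text \<open>The left side is the potential of the root 1 in \<open>light_branch\<close>. A node v on
  level n satisfies v + 1 <= 2 * 2^n, so its probability 2^-n is at most 2 / (v + 1). The levels are
  adjacent intervals, so their sums join into one.\<close>

lemma potential_bound:
  fixes w :: "nat \<Rightarrow> real"
  assumes w: "\<And>v. 0 \<le> w v" and C: "\<And>N. (\<Sum>v<N. w v / real (v + 1)) \<le> C"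
  shows "(\<Sum>n. (1/2)^n * (\<Sum>j<2^n. ennreal (w (2^n * 1 + j)))) \<le> ennreal (2 * C)"
proof (rule suminf_le_const[OF summableI])
  fix N
  have block: "(1/2)^n * (\<Sum>j<2^n. ennreal (w (2^n * 1 + j)))
      \<le> ennreal (2 * (\<Sum>v\<in>{2^n..<2^Suc n}. w v / real (v + 1)))" for n :: nat
  proof -
    have "(1/2)^n = ennreal ((1/2)^n)"
      by (metis divide_ennreal ennreal_1 ennreal_numeral ennreal_power zero_le_divide_1_iff
          zero_le_numeral zero_le_one zero_less_numeral)
    then have "(1/2)^n * (\<Sum>j<2^n. ennreal (w (2^n * 1 + j))) =
        ennreal ((1/2)^n * (\<Sum>j<2^n. w (2^n + j)))"
      using w by (simp add: ennreal_mult sum_nonneg sum_ennreal)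
    also have "(\<Sum>j<2^n. w (2^n + j)) = (\<Sum>v\<in>{2^n..<2^Suc n}. w v)"
      using sum.shift_bounds_nat_ivl[of w 0 "2^n" "2^n"] by (simp add: lessThan_atLeast0 add.commute mult_2)
    also have "(1/2)^n * \<dots> \<le> 2 * (\<Sum>v\<in>{2^n..<2^Suc n}. w v / real (v + 1))"
      unfolding sum_distrib_left
    proof (rule sum_mono)
      fix v :: nat assume v: "v \<in> {2^n..<2^Suc n}"
      then have "v + 1 \<le> 2 * 2^n" by simp
      then have "real (v + 1) \<le> 2 * 2^n" by (metis of_nat_le_iff of_nat_mult of_nat_numeral of_nat_power)
      then have "1/2^n \<le> 2 / real (v + 1)" by (simp add: field_simps)
      from mult_right_mono[OF this w[of v]]
      show "(1/2)^n * w v \<le> 2 * (w v / real (v + 1))" by (simp add: power_one_over)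
    qed
    finally show ?thesis by (simp add: ennreal_leI)
  qed
  have "(\<Sum>n<N. (1/2)^n * (\<Sum>j<2^n. ennreal (w (2^n * 1 + j)))) \<le>
     (\<Sum>n<N. ennreal (2 * (\<Sum>v\<in>{2^n..<2^Suc n}. w v / real (v + 1))))"
    by (intro sum_mono block)
  also have "\<dots> = ennreal (\<Sum>n<N. 2 * (\<Sum>v\<in>{2^n..<2^Suc n}. w v / real (v + 1)))"
    using w by (intro sum_ennreal) (auto intro!: sum_nonneg)
  also have "(\<Sum>n<N. 2 * (\<Sum>v\<in>{2^n..<2^Suc n}. w v / real (v + 1))) =
      2 * (\<Sum>v\<in>{1..<2^N}. w v / real (v + 1))"
  proof (induction N)
    case (Suc N)
    have "(\<Sum>v\<in>{1..<2^N}. w v / real (v + 1)) + (\<Sum>v\<in>{2^N..<2^Suc N}. w v / real (v + 1)) =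
        (\<Sum>v\<in>{1..<2^Suc N}. w v / real (v + 1))"
      by (rule sum.atLeastLessThan_concat) auto
    then show ?case using Suc by simp
  qed simp
  also have "(\<Sum>v\<in>{1..<2^N}. w v / real (v + 1)) \<le> (\<Sum>v<2^N. w v / real (v + 1))"
    using w by (intro sum_mono2) auto
  also have "\<dots> \<le> C" by (rule C)
  finally show "(\<Sum>n<N. (1/2)^n * (\<Sum>j<2^n. ennreal (w (2^n * 1 + j)))) \<le> ennreal (2 * C)"
    by (simp add: ennreal_leI)
qed

text \<open>As 1 / (a b) is at most the mean of 1 / a^2 and 1 / b^2, injectivity bounds both halves
  by the same convergent series. What matters is that the bound depends on neither \<open>p\<close>
  nor \<open>A\<close>.\<close>

lemma sum_inverse_products_bounded:
  fixes p :: "nat \<Rightarrow> nat"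
  assumes "inj_on p A" "finite A"
  shows "(\<Sum>v\<in>A. 1 / (real (p v + 1) * real (v + 1))) \<le> (\<Sum>v. 1 / real (v + 1)^2)"
proof -
  let ?g = "\<lambda>v. 1 / real (v + 1)^2"
  have s: "summable ?g"
    using summable_Suc_iff[of "\<lambda>n. inverse (real n ^ 2)"] inverse_power_summable[of 2, where 'a=real]
    by (simp add: inverse_eq_divide)
  have "1 / (a * b) \<le> (1/a^2 + 1/b^2) / 2" if "a > 0" "b > 0" for a b :: real
    using sum_squares_bound[of "1/a" "1/b"] by (simp add: power_divide)
  then have "(\<Sum>v\<in>A. 1 / (real (p v + 1) * real (v + 1))) \<le> (\<Sum>v\<in>A. (?g (p v) + ?g v) / 2)"
    by (intro sum_mono) simp
  also have "\<dots> = ((\<Sum>v\<in>p ` A. ?g v) + (\<Sum>v\<in>A. ?g v)) / 2"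
    using assms by (simp add: sum.reindex sum.distrib flip: sum_divide_distrib)
  also have "\<dots> \<le> (suminf ?g + suminf ?g) / 2"
    using assms s by (intro divide_right_mono add_mono sum_le_suminf) auto
  finally show ?thesis by simp
qed

text \<open>Beyond some N the series has a tail below e/2, and each later value below m contributes
  at least 1/m to it, so there are at most (e/2) m of these. The first N values become negligible as
  m grows.\<close>

lemma density_0_if_summable:
  fixes y :: "nat \<Rightarrow> nat"
  assumes "inj y" "summable (\<lambda>n. 1 / real (y n + 1))"
  shows "has_density (range y) 0"
  unfolding has_density_def
proof (rule LIMSEQ_I)
  fix e :: real assume e: "e > 0"
  let ?g = "\<lambda>n. 1 / real (y n + 1)"
  obtain N where N: "norm (\<Sum>i. ?g (i + N)) < e / 2"
    using suminf_exist_split[OF _ assms(2), of "e/2"] e by auto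
  have sN: "summable (\<lambda>i. ?g (i + N))" using assms(2) by (subst summable_iff_shift)
  \<comment> \<open>From M on, the first N values account for less than e/2 of the density.\<close>
  obtain M :: nat where M: "real N < e / 2 * M" "M > 0"
    using reals_Archimedean3[of "e/2"] e
    by (metis half_gt_zero mult.commute mult_zero_left not_gr_zero of_nat_0 of_nat_less_0_iff)
  have "norm (partial_density m (range y) - 0) < e" if "m \<ge> M" for m
  proof -
    have m: "m > 0" using that M by simp
    define J where "J = {i. y (i + N) < m}"
    have "inj (\<lambda>i. y (i + N))" by (simp add: inj_def inj_eq[OF assms(1)])
    then have fin: "finite J" unfolding J_def
      using finite_vimageI[of "{..<m}" "\<lambda>i. y (i + N)"] by (simp add: vimage_def)
    have "range y \<inter> {..<m} \<subseteq> y ` {..<N} \<union> (\<lambda>i. y (i + N)) ` J"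
    proof
      fix b assume "b \<in> range y \<inter> {..<m}"
      then obtain n where "b = y n" "y n < m" by auto
      then show "b \<in> y ` {..<N} \<union> (\<lambda>i. y (i + N)) ` J"
        by (cases "n < N") (auto simp: J_def intro!: image_eqI[of _ _ "n - N"])
    qed
    then have "card (range y \<inter> {..<m}) \<le> card (y ` {..<N}) + card ((\<lambda>i. y (i + N)) ` J)"
      using fin by (meson card_Un_le card_mono finite_UnI finite_imageI finite_lessThan order_trans)
    also have "\<dots> \<le> N + card J"
      using fin card_image_le[of "{..<N}" y] by (auto intro!: add_mono card_image_le)
    finally have "real (card (range y \<inter> {..<m})) \<le> real N + real (card J)" by linarith
    moreover have "real N < e / 2 * m"
      using M(1) that e by (smt (verit) mult_left_mono of_nat_le_iff half_gt_zero)
    moreover have "real (card J) \<le> e / 2 * m"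
    proof -
      have "real (card J) / m = (\<Sum>i\<in>J. 1 / real m)" by simp
      also have "\<dots> \<le> (\<Sum>i\<in>J. ?g (i + N))"
        by (intro sum_mono divide_left_mono) (auto simp: J_def)
      also have "\<dots> \<le> (\<Sum>i. ?g (i + N))" using sN fin by (intro sum_le_suminf) auto
      also have "\<dots> \<le> e / 2" using N by simp
      finally show ?thesis using m by (simp add: field_simps)
    qed
    ultimately have "real (card (range y \<inter> {..<m})) < e * m" by linarith
    then show ?thesis using m by (simp add: partial_density_def field_simps)
  qed
  then show "\<exists>no. \<forall>n\<ge>no. norm (partial_density n (range y) - 0) < e" by blast
qed

text \<open>One weight serves all of \<open>P\<close>: the i-th injection enters with factor 2^-i,
  so the uniform bound for one injection gives a bound for the total, and each single series of
  reciprocals is recovered by comparison.\<close>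

lemma exists_light_branch:
  fixes P :: "(nat \<Rightarrow> nat) set"
  assumes "countable P" "\<And>p. p \<in> P \<Longrightarrow> inj p"
  obtains x :: "nat \<Rightarrow> nat" where "x 0 = 0" "\<And>n. x (Suc n) = 2 * x n + 1 \<or> x (Suc n) = 2 * x n + 2"
    "\<And>p. p \<in> P \<Longrightarrow> has_density (p ` range x) 0"
proof -
  \<comment> \<open>\<open>id\<close> makes the set nonempty, so that \<open>from_nat_into\<close>
    enumerates exactly this set; it is injective too.\<close>
  define q where "q = from_nat_into (insert id P)"
  have q: "range q = insert id P"
    unfolding q_def using assms(1) by (intro range_from_nat_into) auto
  have inj: "inj (q i)" for i using q assms(2) by (metis inj_on_id insertE rangeI)
  let ?t = "\<lambda>i v. (1/2)^i * (1 / real (q i v + 1))"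
  define w where "w v = (\<Sum>i. ?t i v)" for v
  have t: "0 \<le> ?t i v" "?t i v \<le> (1/2)^i" for i v
    using mult_left_mono[of "1 / real (q i v + 1)" 1 "(1/2)^i"] by simp_all
  have s: "summable (\<lambda>i. ?t i v)" for v
    by (rule summable_comparison_test'[of "\<lambda>i. (1/2)^i"]) (use t in auto)
  have w0: "0 \<le> w v" for v unfolding w_def using t s by (intro suminf_nonneg) auto
  have tw: "?t i v \<le> w v" for i v
    unfolding w_def using sum_le_suminf[OF s, of "{i}" v] t by auto
  define K where "K = (\<Sum>v. 1 / real (v + 1)^2)"
  have "(\<Sum>v<N. w v / real (v + 1)) \<le> 2 * K" for N
  proof -
    have "(\<Sum>v<N. w v / real (v + 1)) = (\<Sum>v<N. \<Sum>i. ?t i v / real (v + 1))"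
      unfolding w_def by (intro sum.cong refl suminf_divide[symmetric] s)
    also have "\<dots> = (\<Sum>i. \<Sum>v<N. ?t i v / real (v + 1))"
      by (intro suminf_sum[symmetric] summable_divide s)
    also have "\<dots> \<le> (\<Sum>i. (1/2)^i * K)"
    proof (rule suminf_le)
      fix i
      have "(\<Sum>v<N. ?t i v / real (v + 1)) = (1/2)^i * (\<Sum>v<N. 1 / (real (q i v + 1) * real (v + 1)))"
        by (simp add: sum_distrib_left)
      also have "\<dots> \<le> (1/2)^i * K"
        unfolding K_def using inj[of i]
        by (intro mult_left_mono sum_inverse_products_bounded) (auto intro: inj_on_subset)
      finally show "(\<Sum>v<N. ?t i v / real (v + 1)) \<le> (1/2)^i * K" .
    next
      show "summable (\<lambda>i. \<Sum>v<N. ?t i v / real (v + 1))"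
        by (intro summable_sum summable_divide s)
      show "summable (\<lambda>i. (1/2)^i * K)"
        by (intro summable_mult2 summable_geometric) simp
    qed
    also have "\<dots> = 2 * K" by (simp add: suminf_mult2[symmetric] suminf_geometric)
    finally show ?thesis .
  qed
  note bound = this
  \<comment> \<open>This moves the root from 0 to 1, as \<open>light_branch\<close> requires. At 0
    truncated subtraction gives \<open>u 0 = w 0\<close>, the source of the extra \<open>w 0\<close>
    in the bound.\<close>
  define u where "u v = w (v - 1)" for v
  have "(\<Sum>v<N. u v / real (v + 1)) \<le> w 0 + 2 * K" for N
  proof (cases N)
    case 0
    have "0 \<le> K" using bound[of 0] by simp
    then show ?thesis using 0 w0[of 0] by simp
  next
    case (Suc M)
    have "(\<Sum>v<Suc M. u v / real (v + 1)) = w 0 + (\<Sum>v<M. w v / real (v + 2))"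
      by (subst sum.lessThan_Suc_shift) (simp add: u_def)
    also have "(\<Sum>v<M. w v / real (v + 2)) \<le> (\<Sum>v<M. w v / real (v + 1))"
      using w0 by (intro sum_mono divide_left_mono) auto
    also have "\<dots> \<le> 2 * K" by (rule bound)
    finally show ?thesis using Suc by simp
  qed
  from potential_bound[of u, OF _ this] w0
  have pot: "(\<Sum>n. (1/2)^n * (\<Sum>j<2^n. ennreal (u (2^n * 1 + j)))) \<le> ennreal (2 * (w 0 + 2 * K))"
    by (simp add: u_def)
  obtain z where z: "z 0 = 1" "\<And>n. z (Suc n) = 2 * z n \<or> z (Suc n) = 2 * z n + 1"
    "\<And>N. (\<Sum>n<N. ennreal (u (z n))) \<le> (\<Sum>n. (1/2)^n * (\<Sum>j<2^n. ennreal (u (2^n * 1 + j))))"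
    by (rule light_branch[of "\<lambda>v. ennreal (u v)"]) blast
  have pos: "z n \<ge> 1" for n 
  proof (induction n)
    case (Suc n)
    then show ?case using z(2)[of n] by auto
  qed (simp add: z)
  define x where "x n = z n - 1" for n
  have x: "x (Suc n) = 2 * x n + 1 \<or> x (Suc n) = 2 * x n + 2" for n
    using z(2)[of n] pos[of n] by (auto simp: x_def)
  have "x n < x (Suc n)" for n using x[of n] by auto
  then have sm: "strict_mono x" by (simp add: strict_mono_Suc_iff)
  have bd: "(\<Sum>n<N. w (x n)) \<le> 2 * (w 0 + 2 * K)" for N
  proof -
    have "ennreal (\<Sum>n<N. w (x n)) \<le> ennreal (2 * (w 0 + 2 * K))"
      using order_trans[OF z(3)[of N] pot] w0 by (simp add: u_def x_def sum_ennreal)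
    moreover have "0 \<le> 2 * (w 0 + 2 * K)" using w0[of 0] bound[of 0] by simp
    ultimately show ?thesis by (simp add: ennreal_le_iff)
  qed
  have "has_density (p ` range x) 0" if "p \<in> P" for p
  proof -
    obtain i where i: "p = q i" using q \<open>p \<in> P\<close> by (metis insertI2 rangeE)
    have "summable (\<lambda>n. w (x n))"
      by (rule bounded_imp_summable[OF w0, of _ "2 * (w 0 + 2 * K)"])
        (metis bd lessThan_Suc_atMost)
    then have "summable (\<lambda>n. ?t i (x n))"
      by (rule summable_comparison_test') (use t tw in auto)
    then have "summable (\<lambda>n. 1 / real (q i (x n) + 1))"
      by (rule summable_mult_D) simp
    then have "summable (\<lambda>n. 1 / real ((p \<circ> x) n + 1))"
      using i by simp
    moreover have "inj (p \<circ> x)"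
      using inj[of i] i sm by (simp add: inj_compose strict_mono_imp_inj_on)
    ultimately show ?thesis using density_0_if_summable[of "p \<circ> x"] by (simp add: image_comp)
  qed
  with x z(1) show ?thesis by (intro that[of x]) (auto simp: x_def)
qed

section \<open>Countability of the computable functions\<close>

instance recf :: countable by countable_datatype

text \<open>Evaluation is deterministic, so a program computes at most one total unary function, and
  there are only countably many programs.\<close>

lemma countable_computable: "countable {f. computable f}"
proof -
  define r where "r f = (SOME r. \<forall>n. evaluates r [n] (f n))" for f
  have r: "\<forall>n. evaluates (r f) [n] (f n)" if "computable f" for f
    using that unfolding computable_def r_def by (rule someI_ex)
  have "inj_on r {f. computable f}"
    by (rule inj_onI, rule ext) (metis mem_Collect_eq r evaluates_deterministic)
  then show ?thesis by (rule countableI')  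
qed


section \<open>Primitive recursion and minimisation\<close>

text \<open>Fixing the arity and requiring totality allows closure properties to be stated for
  functions, so that no program has to be written out.\<close>

definition recursive :: "nat \<Rightarrow> (nat list \<Rightarrow> nat) \<Rightarrow> bool" where
  "recursive k F \<longleftrightarrow> (\<exists>r. \<forall>xs. length xs = k \<longrightarrow> evaluates r xs (F xs))"

lemma recursive_cong:
  "recursive k F \<Longrightarrow> (\<And>xs. length xs = k \<Longrightarrow> F xs = G xs) \<Longrightarrow> recursive k G"
  unfolding recursive_def by metis

lemma recursive_zero: "recursive k (\<lambda>xs. 0)"
  unfolding recursive_def by (blast intro: evaluates.Zero)

lemma recursive_proj: "i < k \<Longrightarrow> recursive k (\<lambda>xs. xs ! i)"
  unfolding recursive_def by (intro exI[of _ "Proj i"]) (simp add: evaluates.Proj)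

lemma recursive_succ: "recursive 1 (\<lambda>xs. Suc (xs ! 0))"
  unfolding recursive_def
  by (intro exI[of _ Succ]) (auto simp: length_Suc_conv intro: evaluates.Succ)

lemma recursive_comp:
  assumes "recursive (length Fs) G" "\<forall>F\<in>set Fs. recursive k F"
  shows "recursive k (\<lambda>xs. G (map (\<lambda>F. F xs) Fs))"
proof -
  obtain g where g: "\<And>xs. length xs = length Fs \<Longrightarrow> evaluates g xs (G xs)"
    using assms(1) unfolding recursive_def by blast
  obtain h where h: "\<And>F xs. F \<in> set Fs \<Longrightarrow> length xs = k \<Longrightarrow> evaluates (h F) xs (F xs)"
    using assms(2) unfolding recursive_def by metis
  have "evaluates (Comp g (map h Fs)) xs (G (map (\<lambda>F. F xs) Fs))" if "length xs = k" for xs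
    by (rule evaluates.Comp[of _ _ "map (\<lambda>F. F xs) Fs"])
      (use that in \<open>auto simp: list_all2_conv_all_nth intro!: g h\<close>)
  then show ?thesis unfolding recursive_def by blast
qed

lemma recursive_comp1:
  "recursive 1 (\<lambda>xs. g (xs ! 0)) \<Longrightarrow> recursive k F \<Longrightarrow> recursive k (\<lambda>xs. g (F xs))"
  using recursive_comp[of "[F]" "\<lambda>xs. g (xs ! 0)" k] by simp

lemma recursive_comp2:
  "recursive 2 (\<lambda>xs. g (xs ! 0) (xs ! 1)) \<Longrightarrow> recursive k F \<Longrightarrow> recursive k G \<Longrightarrow>
    recursive k (\<lambda>xs. g (F xs) (G xs))"
  using recursive_comp[of "[F, G]" "\<lambda>xs. g (xs ! 0) (xs ! 1)" k] by (simp add: numeral_2_eq_2)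

lemma recursive_primrec:
  assumes "recursive k F" "recursive (Suc (Suc k)) G"
  shows "recursive (Suc k)
    (\<lambda>xs. rec_nat (F (tl xs)) (\<lambda>n y. G (n # y # tl xs)) (hd xs))"
proof -
  obtain f g where f: "\<And>xs. length xs = k \<Longrightarrow> evaluates f xs (F xs)"
    and g: "\<And>xs. length xs = Suc (Suc k) \<Longrightarrow> evaluates g xs (G xs)"
    using assms unfolding recursive_def by blast
  have "evaluates (PrimRec f g) (n # xs) (rec_nat (F xs) (\<lambda>n y. G (n # y # xs)) n)"
    if "length xs = k" for n xs
    using that by (induction n) (auto intro!: evaluates.PrimRec_0 evaluates.PrimRec_Suc f g)
  then show ?thesis unfolding recursive_def
    by (intro exI[of _ "PrimRec f g"]) (auto simp: length_Suc_conv)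
qed

lemma recursive_mu:
  assumes "recursive (Suc k) F" "\<And>xs. length xs = k \<Longrightarrow> \<exists>n. F (n # xs) = 0"
  shows "recursive k (\<lambda>xs. LEAST n. F (n # xs) = 0)"
proof -
  obtain f where f: "\<And>xs. length xs = Suc k \<Longrightarrow> evaluates f xs (F xs)"
    using assms(1) unfolding recursive_def by blast
  have "evaluates (Mu f) xs (LEAST n. F (n # xs) = 0)" if l: "length xs = k" for xs
  proof (rule evaluates.Mu)
    show "evaluates f ((LEAST n. F (n # xs) = 0) # xs) 0"
      using f[of "(LEAST n. F (n # xs) = 0) # xs"] LeastI_ex[OF assms(2)[OF l]] l by simp
    show "\<exists>y. evaluates f (m # xs) (Suc y)" if "m < (LEAST n. F (n # xs) = 0)" for m
      using f[of "m # xs"] not_less_Least[OF that] l by (metis length_Cons not0_implies_Suc)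
  qed
  then show ?thesis unfolding recursive_def by blast
qed

section \<open>Elementary arithmetic functions\<close>

lemma recursive_primrec1:
  assumes g: "g 0 = 0" "\<And>n. g (Suc n) = h n (g n)"
    and h: "recursive 2 (\<lambda>xs. h (xs ! 0) (xs ! 1))" and F: "recursive k F"
  shows "recursive k (\<lambda>xs. g (F xs))"
proof (rule recursive_comp1[where g = g, OF _ F])
  have "rec_nat 0 h n = g n" for n by (induction n) (simp_all add: g)
  moreover have "recursive (Suc (Suc 0)) (\<lambda>xs. h (xs ! 0) (xs ! 1))"
    using h by (simp add: numeral_2_eq_2)
  ultimately show "recursive 1 (\<lambda>xs. g (xs ! 0))"
    using recursive_primrec[OF recursive_zero[of 0], of "\<lambda>xs. h (xs ! 0) (xs ! 1)"]
    by (auto elim!: recursive_cong simp: length_Suc_conv)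
qed

lemma recursive_primrec2:
  assumes g: "\<And>m. g 0 m = m" "\<And>n m. g (Suc n) m = h n (g n m)"
    and h: "recursive 3 (\<lambda>xs. h (xs ! 0) (xs ! 1))" and FG: "recursive k F" "recursive k G"
  shows "recursive k (\<lambda>xs. g (F xs) (G xs))"
proof (rule recursive_comp2[where g = g, OF _ FG])
  have *: "rec_nat m h n = g n m" for n m by (induction n) (simp_all add: g)
  have "recursive (Suc (Suc 1)) (\<lambda>xs. h (xs ! 0) (xs ! 1))"
    using h by (simp add: numeral_3_eq_3)
  from recursive_primrec[OF recursive_proj[of 0 1] this]
  show "recursive 2 (\<lambda>xs. g (xs ! 0) (xs ! 1))"
    by (auto elim!: recursive_cong simp: length_Suc_conv numeral_2_eq_2 *)
qed

lemma recursive_Suc: "recursive k F \<Longrightarrow> recursive k (\<lambda>xs. Suc (F xs))"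
  using recursive_succ by (rule recursive_comp1)

lemma recursive_pred: "recursive k F \<Longrightarrow> recursive k (\<lambda>xs. F xs - 1)"
  by (rule recursive_primrec1[where g = "\<lambda>n. n - 1" and h = "\<lambda>n y. n"])
    (simp_all add: recursive_proj)

lemma recursive_add: "recursive k F \<Longrightarrow> recursive k G \<Longrightarrow> recursive k (\<lambda>xs. F xs + G xs)"
  by (rule recursive_primrec2[where g = "(+)" and h = "\<lambda>n y. Suc y"])
    (simp_all add: recursive_proj recursive_Suc)

lemma recursive_diff: "recursive k F \<Longrightarrow> recursive k G \<Longrightarrow> recursive k (\<lambda>xs. F xs - G xs)"
  by (rule recursive_primrec2[where g = "\<lambda>n m. m - n" and h = "\<lambda>n y. y - 1"])
    (simp_all add: recursive_proj recursive_pred[simplified])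

lemma recursive_parity: "recursive k F \<Longrightarrow> recursive k (\<lambda>xs. F xs mod 2)"
  by (rule recursive_primrec1[where g = "\<lambda>n. n mod 2" and h = "\<lambda>n y. Suc 0 - y"])
    (simp_all add: mod_Suc recursive_proj recursive_Suc recursive_diff recursive_zero)

text \<open>Recursion on the tested value: the base case keeps the other argument, every successor
  step discards it. This provides the case distinction of the skip rule.\<close>

lemma recursive_if_zero:
  "recursive k F \<Longrightarrow> recursive k G \<Longrightarrow> recursive k (\<lambda>xs. if F xs = 0 then G xs else 0)"
  by (rule recursive_primrec2[where g = "\<lambda>n m. if n = 0 then m else 0" and h = "\<lambda>n y. 0"])
    (simp_all add: recursive_zero)

section \<open>Decoding of pairs\<close>

lemma recursive_triangle: "recursive k F \<Longrightarrow> recursive k (\<lambda>xs. triangle (F xs))"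
  by (rule recursive_primrec1[where g = triangle and h = "\<lambda>n y. y + Suc n"])
    (simp_all add: recursive_proj recursive_add recursive_Suc del: add_Suc_right)

text \<open>The condition is \<open>z < triangle (Suc s)\<close>, written as the zero of a function that
  minimisation looks for.\<close>

definition antidiagonal :: "nat \<Rightarrow> nat" where
  "antidiagonal z = (LEAST s. Suc z - triangle (Suc s) = 0)"

lemma le_triangle: "n \<le> triangle n"
  by (induction n) auto

lemma recursive_antidiagonal:
  assumes "recursive k F"
  shows "recursive k (\<lambda>xs. antidiagonal (F xs))"
proof (rule recursive_comp1[where g = antidiagonal, OF _ assms])
  have "\<exists>n. Suc c - triangle (Suc n) = 0" for c
    using le_triangle[of "Suc c"] by (intro exI[of _ c]) simp
  moreover have "recursive (Suc 1) (\<lambda>xs. Suc (xs ! 1) - triangle (Suc (xs ! 0)))"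
    by (intro recursive_diff recursive_triangle recursive_Suc recursive_proj) simp_all
  ultimately show "recursive 1 (\<lambda>xs. antidiagonal (xs ! 0))"
    unfolding antidiagonal_def
    using recursive_mu[of 1 "\<lambda>xs. Suc (xs ! 1) - triangle (Suc (xs ! 0))"] by simp
qed

text \<open>The code is \<open>triangle (a + b) + a\<close>, hence at least
  \<open>triangle (a + b)\<close> and below \<open>triangle (Suc (a + b))\<close>.\<close>

lemma antidiagonal_prod_encode: "antidiagonal (prod_encode (a, b)) = a + b"
  unfolding antidiagonal_def
proof (rule Least_equality)
  show "Suc (prod_encode (a, b)) - triangle (Suc (a + b)) = 0"
    by (simp add: prod_encode_def)
  fix s assume s: "Suc (prod_encode (a, b)) - triangle (Suc s) = 0"
  have mono: "triangle m \<le> triangle n" if "m \<le> n" for m n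
    using that by (induction rule: dec_induct) auto
  show "a + b \<le> s"
  proof (rule ccontr)
    assume "\<not> a + b \<le> s"
    then show False using mono[of "Suc s" "a + b"] s by (simp add: prod_encode_def)
  qed
qed

lemma fst_prod_decode: "fst (prod_decode z) = z - triangle (antidiagonal z)"
proof -
  obtain a b where ab: "prod_decode z = (a, b)" by fastforce
  then have "z = prod_encode (a, b)" by (metis prod_decode_inverse)
  then have "antidiagonal z = a + b" "z = triangle (a + b) + a"
    by (simp add: antidiagonal_prod_encode, simp add: prod_encode_def)
  then show ?thesis using ab by simp
qed

lemma snd_prod_decode: "snd (prod_decode z) = antidiagonal z - fst (prod_decode z)"
proof -
  obtain a b where ab: "prod_decode z = (a, b)" by fastforce
  then have "z = prod_encode (a, b)" by (metis prod_decode_inverse)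
  then show ?thesis using antidiagonal_prod_encode[of a b] by simp
qed

lemma recursive_fst: "recursive k F \<Longrightarrow> recursive k (\<lambda>xs. fst (prod_decode (F xs)))"
  unfolding fst_prod_decode
  by (intro recursive_diff recursive_triangle recursive_antidiagonal)

lemma recursive_snd: "recursive k F \<Longrightarrow> recursive k (\<lambda>xs. snd (prod_decode (F xs)))"
  unfolding snd_prod_decode by (intro recursive_diff recursive_fst recursive_antidiagonal)

section \<open>Decoding of lists\<close>

text \<open>A nonempty list has as code the successor of a pair code, which the subtraction undoes.
  For the empty list, 0 - 1 = 0 decodes to (0, 0), so its code 0 is a fixed point, in accordance
  with \<open>tl []\<close>.\<close>

definition tail_code :: "nat \<Rightarrow> nat" where
  "tail_code c = snd (prod_decode (c - 1))"

lemma tail_code_list_encode: "tail_code (list_encode xs) = list_encode (tl xs)"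
proof (cases xs)
  case Nil
  have "prod_encode (0, 0) = 0" by (simp add: prod_encode_def)
  then have "prod_decode 0 = (0, 0)" by (metis prod_encode_inverse)
  then show ?thesis using Nil by (simp add: tail_code_def)
qed (simp add: tail_code_def)

lemma funpow_tail_code: "(tail_code ^^ n) (list_encode xs) = list_encode (drop n xs)"
  by (induction n) (simp_all add: tail_code_list_encode drop_Suc tl_drop)

lemma recursive_funpow_tail_code:
  "recursive k F \<Longrightarrow> recursive k G \<Longrightarrow> recursive k (\<lambda>xs. (tail_code ^^ F xs) (G xs))"
proof (rule recursive_primrec2[where g = "\<lambda>n m. (tail_code ^^ n) m" and h = "\<lambda>n y. tail_code y"])
  show "recursive 3 (\<lambda>xs. tail_code (xs ! 1))"
    unfolding tail_code_def by (intro recursive_snd recursive_pred recursive_proj) simp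
qed simp_all

lemma list_encode_eq_0_iff: "list_encode xs = 0 \<longleftrightarrow> xs = []"
  by (cases xs) auto

text \<open>Only the empty list has code 0, so the search stops after as many tails as there are
  entries.\<close>

definition length_code :: "nat \<Rightarrow> nat" where
  "length_code c = (LEAST n. (tail_code ^^ n) c = 0)"

lemma length_code_list_encode: "length_code (list_encode xs) = length xs"
  unfolding length_code_def funpow_tail_code list_encode_eq_0_iff drop_eq_Nil
  by (rule Least_equality) auto

lemma recursive_length_code:
  assumes "recursive k F"
  shows "recursive k (\<lambda>xs. length_code (F xs))"
proof (rule recursive_comp1[where g = length_code, OF _ assms])
  have "\<exists>n. (tail_code ^^ n) c = 0" for c
    using funpow_tail_code[of "length (list_decode c)" "list_decode c"] by auto
  moreover have "recursive (Suc 1) (\<lambda>xs. (tail_code ^^ (xs ! 0)) (xs ! 1))"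
    by (intro recursive_funpow_tail_code recursive_proj) simp_all
  ultimately show "recursive 1 (\<lambda>xs. length_code (xs ! 0))"
    unfolding length_code_def
    using recursive_mu[of 1 "\<lambda>xs. (tail_code ^^ (xs ! 0)) (xs ! 1)"] by simp
qed

definition last_code :: "nat \<Rightarrow> nat" where
  "last_code c = fst (prod_decode ((tail_code ^^ (length_code c - 1)) c - 1))"

lemma last_code_list_encode: "xs \<noteq> [] \<Longrightarrow> last_code (list_encode xs) = last xs"
  by (cases xs rule: rev_cases)
    (simp_all add: last_code_def length_code_list_encode funpow_tail_code)

text \<open>This default is also the code of \<open>(0, False)\<close>, so an empty history reads as
  the artificial first query of \<open>branch_rule\<close>.\<close>

lemma last_code_0: "last_code 0 = 0"
  using length_code_list_encode[of "[]"]
  by (simp add: last_code_def fst_prod_decode)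

lemma recursive_last_code: "recursive k F \<Longrightarrow> recursive k (\<lambda>xs. last_code (F xs))"
  unfolding last_code_def
  by (intro recursive_fst recursive_pred recursive_funpow_tail_code recursive_length_code)

section \<open>Following a branch by a skip rule\<close>

text \<open>The query \<open>(0, False)\<close> in front of the history makes the rule start at the left child
  \<open>1\<close> of the root, without querying the root itself.\<close>

definition branch_rule :: "(nat \<times> bool) list \<Rightarrow> nat" where
  "branch_rule \<sigma> = (case last ((0, False) # \<sigma>) of (d, b) \<Rightarrow>
    if odd d \<and> \<not> b then Suc d else 2 * d + 1)"

lemma skip_rule_branch_rule: "skip_rule branch_rule"
  unfolding skip_rule_def branch_rule_def by (auto split: prod.splits)

lemma computable_branch_rule: "computable_skip_rule branch_rule"
proof -
  define d b where "d = (\<lambda>c. fst (prod_decode (last_code c)))"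
    and "b = (\<lambda>c. snd (prod_decode (last_code c)))"
  \<comment> \<open>On codes of histories the bit is at most 1, so the truncated difference is
    nonzero exactly when d is odd and the bit is 0. The two cases of the rule are
    \<open>Suc d\<close> plus 0 and \<open>Suc d\<close> plus d.\<close>
  define F where "F c = Suc (d c + (if d c mod 2 - b c = 0 then d c else 0))" for c
  have "recursive 1 (\<lambda>xs. F (xs ! 0))"
    unfolding F_def d_def b_def
    by (intro recursive_Suc recursive_add recursive_if_zero recursive_diff recursive_parity
        recursive_fst recursive_snd recursive_last_code recursive_proj) simp_all
  then obtain r where "\<forall>xs. length xs = 1 \<longrightarrow> evaluates r xs (F (xs ! 0))"
    unfolding recursive_def by blast
  then have r: "evaluates r [c] (F c)" for c
    by (drule_tac spec[of _ "[c]"]) simp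
  have "F (skip_seq_encode \<sigma>) = branch_rule \<sigma>" for \<sigma>
  proof (cases "\<sigma> = []")
    case True
    have "d 0 = 0" by (simp add: d_def last_code_0 fst_prod_decode)
    then show ?thesis using True by (simp add: F_def branch_rule_def skip_seq_encode_def)
  next
    case False
    obtain e a where ea: "last \<sigma> = (e, a)" by fastforce
    have "last_code (skip_seq_encode \<sigma>) = prod_encode (e, of_bool a)"
      using False ea by (simp add: skip_seq_encode_def last_code_list_encode last_map)
    then show ?thesis using False ea
      by (auto simp: F_def d_def b_def branch_rule_def odd_iff_mod_2_eq_one)
  qed
  then show ?thesis
    unfolding computable_skip_rule_def using skip_rule_branch_rule r by metis
qed

lemma skip_select_branch_rule_0: "skip_select branch_rule X 0 = 1"
  by (simp add: skip_select_def branch_rule_def)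

lemma skip_select_branch_rule_Suc:
  "skip_select branch_rule X (Suc n) = (let d = skip_select branch_rule X n in
    if odd d \<and> d \<notin> X then Suc d else 2 * d + 1)"
  by (simp add: skip_select_def branch_rule_def Let_def)

text \<open>Left children are the odd numbers. After a hit the rule asks for the left child; if that
  misses, the branch goes through the right sibling, which is the next query.\<close>

lemma miss_then_hit:
  fixes x :: "nat \<Rightarrow> nat"
  assumes x: "x 0 = 0" "\<And>n. x (Suc n) = 2 * x n + 1 \<or> x (Suc n) = 2 * x n + 2"
  shows "n \<in> skip_image branch_rule (range x) \<or> Suc n \<in> skip_image branch_rule (range x)"
proof -
  let ?d = "skip_select branch_rule (range x)"
  \<comment> \<open>Every query is on the branch or is a left child whose right sibling is on
    it.\<close>
  have inv: "\<exists>k. ?d n = x k \<or> ?d n = 2 * x k + 1 \<and> x (Suc k) = Suc (?d n)" for n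
  proof (induction n)
    case 0
    \<comment> \<open>The witness is 1 if the branch starts to the left, and 0 otherwise.\<close>
    show ?case using x(1) x(2)[of 0]
      by (auto simp: skip_select_branch_rule_0 intro: exI[of _ "0::nat"] exI[of _ "Suc 0"])
  next
    case (Suc n)
    show ?case
    proof (cases "?d n \<in> range x")
      case True
      then obtain k where k: "?d n = x k" by blast
      then have "?d (Suc n) = 2 * x k + 1"
        using True by (simp add: skip_select_branch_rule_Suc Let_def)
      then show ?thesis using x(2)[of k] by (metis Suc_eq_plus1 add_2_eq_Suc' )
    next
      case False
      then obtain k where "?d n = 2 * x k + 1" "x (Suc k) = Suc (?d n)"
        using Suc by blast
      then have "?d (Suc n) = x (Suc k)"
        using False by (simp add: skip_select_branch_rule_Suc Let_def)
      then show ?thesis by blast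
    qed
  qed
  have "?d (Suc n) \<in> range x" if miss: "?d n \<notin> range x"
  proof -
    obtain k where "?d n = 2 * x k + 1" "x (Suc k) = Suc (?d n)"
      using inv[of n] miss by blast
    then have "?d (Suc n) = x (Suc k)"
      using miss by (simp add: skip_select_branch_rule_Suc Let_def)
    then show ?thesis by simp
  qed
  then show ?thesis unfolding skip_image_def by blast
qed

section \<open>Positive density of the hits, and the conclusion\<close>

text \<open>Each of the disjoint pairs {2 m, 2 m + 1} meets \<open>B\<close>, so the partial density
  is at least 1/2 at every positive even number.\<close>

lemma not_density_0_if_syndetic:
  assumes B: "\<And>n. n \<in> B \<or> Suc n \<in> B"
  shows "\<not> has_density B 0"
proof
  assume "has_density B 0"
  then have "eventually (\<lambda>n. partial_density n B < 1/2) sequentially"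
    unfolding has_density_def by (rule order_tendstoD) simp
  then obtain N where N: "\<And>n. n \<ge> N \<Longrightarrow> partial_density n B < 1/2"
    unfolding eventually_sequentially by blast
  have card: "m \<le> card (B \<inter> {..<2*m})" for m
  proof (induction m)
    case (Suc m)
    obtain e where e: "e \<in> B" "e = 2*m \<or> e = Suc (2*m)" using B by blast
    have "Suc (card (B \<inter> {..<2*m})) = card (insert e (B \<inter> {..<2*m}))"
      using e(2) by (subst card_insert_disjoint) auto
    also have "\<dots> \<le> card (B \<inter> {..<2*Suc m})" using e by (intro card_mono) auto
    finally show ?case using Suc by simp
  qed simp
  show False using N[of "2 * Suc N"] card[of "Suc N"]
    by (simp add: partial_density_def field_simps)
qed

theorem theorem3:
  "\<exists>X :: nat set. intrinsically_small X \<and> \<not> weakly_stochastic_0 X"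
proof -
  have "countable {p. bij p \<and> computable p}"
    by (rule countable_subset[OF _ countable_computable]) blast
  then obtain x :: "nat \<Rightarrow> nat" where x: "x 0 = 0"
      "\<And>n. x (Suc n) = 2 * x n + 1 \<or> x (Suc n) = 2 * x n + 2"
    and dens: "\<And>p. p \<in> {p. bij p \<and> computable p} \<Longrightarrow> has_density (p ` range x) 0"
    by (rule exists_light_branch) (auto simp: bij_def)
  have "\<not> has_density (skip_image branch_rule (range x)) 0"
    by (rule not_density_0_if_syndetic) (rule miss_then_hit[OF x])
  then have "\<not> weakly_stochastic_0 (range x)"
    unfolding weakly_stochastic_0_def using computable_branch_rule by blast
  moreover have "intrinsically_small (range x)"
    unfolding intrinsically_small_def using dens by blast
  ultimately show ?thesis by blast
qed

end
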